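(* Let $k\subset L$ be an FCP radicial field extension. The following conditions are equivalent: (1) $k\subset L$ is chained; (2) $k\subset L$ is distributive; (3) $k\subset L$ has FIP.
   Context: For a field extension $k\subset L$, $[k,L]$ denotes the set of all $k$-subalgebras of $L$ ordered by inclusion (for an algebraic extension these are the intermediate fields); it is a lattice with infimum $T\cap U$ and supremum the compositum $TU$. The extension has FCP if every chain in $[k,L]$ is finite, FIP if $[k,L]$ is finite, is chained if $[k,L]$ is totally ordered by inclusion, and is distributive if the lattice $[k,L]$ is distributive. Radicial means purely inseparable. *)

theory Defs
  imports "HOL-Algebra.Algebra"
begin

text \<open>
  A field extension \<open>k \<subseteq> L\<close> is given by a \<^const>\<open>field\<close> structure \<open>L\<close> and a set \<open>k\<close> with
  \<^term>\<open>subfield k L\<close>; the trivial extension \<^term>\<open>k = carrier L\<close> is allowed.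
\<close>

text \<open>
  The set \<open>[k, L]\<close>. The locale \<^const>\<open>subalgebra\<close> of the library is not used, because its instances
  need not be closed under multiplication nor contain \<open>\<one>\<close>: they are just the \<open>k\<close>-subspaces.
\<close>

definition subalgs :: "'a set \<Rightarrow> ('a, 'b) ring_scheme \<Rightarrow> 'a set set" where
  "subalgs k L = {T. subring T L \<and> k \<subseteq> T}"

definition subalg_lattice :: "'a set \<Rightarrow> ('a, 'b) ring_scheme \<Rightarrow> 'a set gorder" where
  "subalg_lattice k L = \<lparr>carrier = subalgs k L, eq = (=), le = (\<subseteq>)\<rparr>"

definition FCP :: "'a set \<Rightarrow> ('a, 'b) ring_scheme \<Rightarrow> bool" where
  "FCP k L \<longleftrightarrow> (\<forall>C. subset.chain (subalgs k L) C \<longrightarrow> finite C)"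

definition FIP :: "'a set \<Rightarrow> ('a, 'b) ring_scheme \<Rightarrow> bool" where
  "FIP k L \<longleftrightarrow> finite (subalgs k L)"

definition chained_ext :: "'a set \<Rightarrow> ('a, 'b) ring_scheme \<Rightarrow> bool" where
  "chained_ext k L \<longleftrightarrow> total_order (subalg_lattice k L)"

definition distributive_lattice :: "('a, 'b) gorder_scheme \<Rightarrow> bool" where
  "distributive_lattice P \<longleftrightarrow> lattice P \<and>
     (\<forall>x \<in> carrier P. \<forall>y \<in> carrier P. \<forall>z \<in> carrier P.
        x \<sqinter>\<^bsub>P\<^esub> (y \<squnion>\<^bsub>P\<^esub> z) = (x \<sqinter>\<^bsub>P\<^esub> y) \<squnion>\<^bsub>P\<^esub> (x \<sqinter>\<^bsub>P\<^esub> z))"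

definition distributive_ext :: "'a set \<Rightarrow> ('a, 'b) ring_scheme \<Rightarrow> bool" where
  "distributive_ext k L \<longleftrightarrow> distributive_lattice (subalg_lattice k L)"

text \<open>
  \<^const>\<open>group.ord\<close> is \<open>0\<close> on elements of infinite order, so the additive order of \<open>\<one>\<close> is the
  characteristic in the usual sense.
\<close>

definition field_char :: "('a, 'b) ring_scheme \<Rightarrow> nat" where
  "field_char L = group.ord (add_monoid L) \<one>\<^bsub>L\<^esub>"

definition char_exponent :: "('a, 'b) ring_scheme \<Rightarrow> nat" where
  "char_exponent L = (if field_char L = 0 then 1 else field_char L)"

text \<open>
  Using the characteristic exponent \<open>q\<close> covers characteristic \<open>0\<close> as well: there \<open>q = 1\<close>, and only
  the trivial extension is radicial.
\<close>

definition radicial_ext :: "'a set \<Rightarrow> ('a, 'b) ring_scheme \<Rightarrow> bool" where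
  "radicial_ext k L \<longleftrightarrow> (\<forall>x \<in> carrier L. \<exists>n::nat. x [^]\<^bsub>L\<^esub> (char_exponent L ^ n) \<in> k)"

text \<open>The order-theoretic infimum and supremum in \<open>[k, L]\<close> are intersection and compositum.\<close>

lemma subalg_lattice_simps [simp]:
  "carrier (subalg_lattice k L) = subalgs k L"
  "eq (subalg_lattice k L) = (=)"
  "le (subalg_lattice k L) = (\<subseteq>)"
  by (simp_all add: subalg_lattice_def)

lemma partial_order_subalg_lattice: "partial_order (subalg_lattice k L)"
  by unfold_locales auto

lemma (in ring) greatest_subalg_inter:
  assumes "T \<in> subalgs k R" "U \<in> subalgs k R"
  shows "greatest (subalg_lattice k R) (T \<inter> U) (Lower (subalg_lattice k R) {T, U})"
proof -
  have "T \<inter> U \<in> subalgs k R"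
    using assms subring_inter[of T U] by (auto simp: subalgs_def)
  then show ?thesis
    using assms by (auto simp: greatest_def Lower_def)
qed

lemma (in ring) least_subalg_compositum:
  assumes "T \<in> subalgs k R" "U \<in> subalgs k R"
  shows "least (subalg_lattice k R) (generate_ring R (T \<union> U)) (Upper (subalg_lattice k R) {T, U})"
proof -
  have sub: "T \<union> U \<subseteq> carrier R"
    using assms subringE(1) by (auto simp: subalgs_def)
  have "generate_ring R (T \<union> U) \<in> subalgs k R"
    using generate_ring_is_subring[OF sub] generate_ring.incl[of _ "T \<union> U" R] assms
    by (auto simp: subalgs_def)
  moreover have "generate_ring R (T \<union> U) \<subseteq> V" if "V \<in> subalgs k R" "T \<subseteq> V" "U \<subseteq> V" for V
    using generate_ring_min_subring1[of "T \<union> U" V] that sub subringE(1)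
    by (auto simp: subalgs_def)
  ultimately show ?thesis
    using assms generate_ring.incl[of _ "T \<union> U" R] by (auto simp: least_def Upper_def)
qed

lemma (in ring) lattice_subalg_lattice: "lattice (subalg_lattice k R)"
proof -
  interpret P: partial_order "subalg_lattice k R"
    by (rule partial_order_subalg_lattice)
  show ?thesis
    by unfold_locales (auto intro: greatest_subalg_inter least_subalg_compositum)
qed

lemma (in ring) meet_subalg_lattice:
  assumes "T \<in> subalgs k R" "U \<in> subalgs k R"
  shows "T \<sqinter>\<^bsub>subalg_lattice k R\<^esub> U = T \<inter> U"
proof -
  interpret P: lattice "subalg_lattice k R"
    by (rule lattice_subalg_lattice)
  show ?thesis
    unfolding meet_def inf_def using greatest_subalg_inter[OF assms] P.greatest_unique
    by (intro some_equality) auto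
qed

lemma (in ring) join_subalg_lattice:
  assumes "T \<in> subalgs k R" "U \<in> subalgs k R"
  shows "T \<squnion>\<^bsub>subalg_lattice k R\<^esub> U = generate_ring R (T \<union> U)"
proof -
  interpret P: lattice "subalg_lattice k R"
    by (rule lattice_subalg_lattice)
  show ?thesis
    unfolding join_def sup_def using least_subalg_compositum[OF assms] P.least_unique
    by (intro some_equality) auto
qed

end

theory Submission
  imports Defs
begin

text \<open>
  Let \<open>q\<close> be the characteristic exponent. Radiciality makes every \<open>k\<close>-subalgebra of \<open>L\<close> a field.

  A chain is a distributive lattice, and under FCP it is finite. Both converses rest on one
  construction. Suppose \<open>T\<close> and \<open>U\<close> are incomparable members of \<open>[k, L]\<close>. Taking \<open>q\<close>-th powers one
  finds \<open>t \<in> T - U\<close> with \<open>t\<^sup>q \<in> U\<close> and \<open>u \<in> U - T\<close> with \<open>u\<^sup>q \<in> T\<close>; in particular \<open>q\<close> is a prime.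
  For nonzero \<open>c \<in> k\<close> put \<open>F = T \<inter> U\<close>, \<open>w = t + c u\<close> and \<open>W = F(w)\<close>. Then \<open>w\<^sup>q \<in> F\<close>, and \<open>w\<close> lies
  neither in \<open>T\<close> nor in \<open>U\<close>. From this it follows that \<open>W \<inter> T = F = W \<inter> U\<close>
  (\<open>incomparable_pair_diagonal\<close>).

  This contradicts distributivity, because \<open>w \<in> W \<inter> TU\<close> while the compositum of \<open>W \<inter> T\<close> and
  \<open>W \<inter> U\<close> is \<open>F\<close>, which does not contain \<open>w\<close>. It also contradicts FIP when \<open>k\<close> is infinite,
  because different \<open>c\<close> give different \<open>W\<close>: a subalgebra \<open>W\<close> that contains \<open>t + c u\<close> and \<open>t + d u\<close>
  with \<open>c \<noteq> d\<close> contains \<open>u\<close>, and \<open>u \<in> W \<inter> U = F \<subseteq> T\<close> is false. If \<open>k\<close> is finite it is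
  perfect, so \<open>L = k\<close> and there are no incomparable members at all.

  The intersections are computed from the fact that a \<open>q\<close>-th root \<open>w\<close> of an element of a field
  \<open>K\<close> has degree \<open>q\<close> over \<open>K\<close> unless it lies in \<open>K\<close> (\<open>purely_inseparable_degree_ge\<close>). For then
  an element of \<open>F(w)\<close>, written as a polynomial in \<open>w\<close> over \<open>F\<close> of degree less than \<open>q\<close>, can only lie
  in an intermediate field \<open>K\<close> that omits \<open>w\<close> if that polynomial is constant
  (\<open>inter_simple_extension_eq\<close>).
\<close>

section \<open>The Frobenius map\<close>

lemma (in cring) add_pow_finsum_binomial:
  assumes x: "x \<in> carrier R" and y: "y \<in> carrier R"
  shows "(x \<oplus> y) [^] (n::nat) = (\<Oplus>k\<in>{..n}. [(n choose k)] \<cdot> (x [^] k \<otimes> y [^] (n - k)))"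
proof (induction n)
  case 0
  show ?case by (simp add: x y)
next
  case (Suc n)
  let ?t = "\<lambda>m k. x [^] k \<otimes> y [^] (m - k)"
  let ?S = "\<Oplus>k\<in>{..n}. [(n choose k)] \<cdot> ?t n k"
  have cl: "?t m k \<in> carrier R" for m k :: nat
    using x y by simp
  have xS: "x \<otimes> ?S = (\<Oplus>k\<in>{..n}. [(n choose k)] \<cdot> ?t (Suc n) (Suc k))"
    using x y cl
    by (subst finsum_rdistr) (auto intro!: finsum_cong' simp: add_pow_rdistr m_ac)
  have yS: "y \<otimes> ?S = (\<Oplus>k\<in>{..n}. [(n choose k)] \<cdot> ?t (Suc n) k)"
    using x y cl
    by (subst finsum_rdistr) (auto intro!: finsum_cong' simp: add_pow_rdistr m_ac Suc_diff_le)
  \<comment> \<open>Splitting off the summand \<open>k = n + 1\<close>, which is \<open>0\<close>, or the summand \<open>k = 0\<close>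
     gives two forms of the same sum; the second one matches Pascal's rule.\<close>
  have shift: "y \<otimes> ?S = (\<Oplus>k\<in>{..n}. [(n choose Suc k)] \<cdot> ?t (Suc n) (Suc k)) \<oplus> y [^] Suc n"
  proof -
    have "(\<Oplus>k\<in>{..Suc n}. [(n choose k)] \<cdot> ?t (Suc n) k) = y \<otimes> ?S"
      using x y cl yS by (subst finsum_Suc) (auto simp: binomial_eq_0)
    moreover have "(\<Oplus>k\<in>{..Suc n}. [(n choose k)] \<cdot> ?t (Suc n) k)
        = (\<Oplus>k\<in>{..n}. [(n choose Suc k)] \<cdot> ?t (Suc n) (Suc k)) \<oplus> y [^] Suc n"
      using x y cl by (subst finsum_Suc2) auto
    ultimately show ?thesis by simp
  qed
  have "(x \<oplus> y) [^] Suc n = x \<otimes> ?S \<oplus> y \<otimes> ?S"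
    using x y cl Suc.IH by (simp add: m_comm[of _ "x \<oplus> y"] l_distr)
  also have "\<dots> = (\<Oplus>k\<in>{..n}. [(n choose k)] \<cdot> ?t (Suc n) (Suc k))
      \<oplus> (\<Oplus>k\<in>{..n}. [(n choose Suc k)] \<cdot> ?t (Suc n) (Suc k)) \<oplus> y [^] Suc n"
    unfolding xS shift using x y cl by (simp add: a_assoc del: nat_pow_Suc)
  also have "\<dots> = (\<Oplus>k\<in>{..n}. [(Suc n choose Suc k)] \<cdot> ?t (Suc n) (Suc k)) \<oplus> y [^] Suc n"
    using x y cl by (simp add: finsum_addf[symmetric] add.nat_pow_mult del: nat_pow_Suc)
  also have "\<dots> = (\<Oplus>k\<in>{..Suc n}. [(Suc n choose k)] \<cdot> ?t (Suc n) k)"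
    using x y cl by (subst finsum_Suc2) auto
  finally show ?case .
qed

text \<open>
  The characteristic enters as \<open>[p] \<cdot> \<one> = \<zero>\<close> because the statement is applied both to the
  field and to its polynomial ring. The inner binomial coefficients are divisible by \<open>p\<close>, so
  only the two outer summands of the binomial formula survive.
\<close>

lemma (in cring) frobenius_add:
  assumes p: "Factorial_Ring.prime p" and char: "[p] \<cdot> \<one> = \<zero>"
    and x: "x \<in> carrier R" and y: "y \<in> carrier R"
  shows "(x \<oplus> y) [^] p = x [^] p \<oplus> y [^] (p::nat)"
proof -
  have p0: "p > 0" using p prime_gt_0_nat by blast
  have mult: "[(p * m)] \<cdot> z = \<zero>" if "z \<in> carrier R" for m :: nat and z
  proof -
    have "[(p * m)] \<cdot> z = [m] \<cdot> ([p] \<cdot> (\<one> \<otimes> z))"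
      using that by (simp add: add.nat_pow_pow mult.commute)
    also have "\<dots> = [m] \<cdot> \<zero>"
      using that char by (simp add: add_pow_ldistr[symmetric] del: l_one)
    finally show ?thesis by simp
  qed
  let ?f = "\<lambda>k. [(p choose k)] \<cdot> (x [^] k \<otimes> y [^] (p - k))"
  have cl: "?f \<in> UNIV \<rightarrow> carrier R" using x y by auto
  have mid: "?f (Suc k) = \<zero>" if "k < p - 1" for k
  proof -
    have "p dvd p choose Suc k"
      using that p by (intro dvd_choose_prime) auto
    then show ?thesis using mult x y by (auto elim!: dvdE)
  qed
  obtain m where m: "p = Suc m" using p0 gr0_implies_Suc by blast
  have "(x \<oplus> y) [^] p = (\<Oplus>k\<in>{..p}. ?f k)"
    by (rule add_pow_finsum_binomial[OF x y])
  also have "\<dots> = ?f p \<oplus> (\<Oplus>k\<in>{..m}. ?f k)"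
    unfolding m by (rule finsum_Suc) (use cl m in auto)
  also have "(\<Oplus>k\<in>{..m}. ?f k) = (\<Oplus>k\<in>{..m}. if 0 = k then ?f k else \<zero>)"
  proof (rule finsum_cong')
    show "(\<lambda>k. if 0 = k then ?f k else \<zero>) \<in> {..m} \<rightarrow> carrier R" using x y by auto
    show "?f k = (if 0 = k then ?f k else \<zero>)" if "k \<in> {..m}" for k
      using mid[of "k - 1"] that m by (cases k) (simp_all del: binomial_Suc_Suc)
  qed simp
  also have "\<dots> = ?f 0"
    by (rule add.finprod_singleton) (use cl in auto)
  finally show ?thesis using x y by simp
qed

lemma (in domain) nat_pow_eq_zero:
  "x \<in> carrier R \<Longrightarrow> x [^] (n::nat) = \<zero> \<Longrightarrow> x = \<zero>"
  by (induction n) (auto simp: integral_iff)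

text \<open>
  The Frobenius map is additive and a domain has no nilpotent elements: \<open>(x - y)\<^sup>p = x\<^sup>p - y\<^sup>p\<close>.
\<close>

lemma (in domain) frobenius_inj:
  assumes p: "Factorial_Ring.prime p" and char: "[p] \<cdot> \<one> = \<zero>"
    and x: "x \<in> carrier R" and y: "y \<in> carrier R" and eq: "x [^] p = y [^] (p::nat)"
  shows "x = y"
proof -
  have "x [^] p = (x \<ominus> y) [^] p \<oplus> y [^] p"
    using frobenius_add[OF p char, of "x \<ominus> y" y] x y by (simp add: a_minus_def a_assoc l_neg)
  then have "(x \<ominus> y) [^] p = \<zero>"
    using eq x y by (metis add.r_cancel_one' minus_closed nat_pow_closed)
  then have "x \<ominus> y = \<zero>"
    using nat_pow_eq_zero x y by blast
  then show ?thesis using x y by simp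
qed

lemma (in domain) frobenius_pow_inj:
  assumes p: "Factorial_Ring.prime p" and char: "[p] \<cdot> \<one> = \<zero>"
    and "x \<in> carrier R" and "y \<in> carrier R" and "x [^] (p ^ n) = y [^] ((p::nat) ^ n)"
  shows "x = y"
  using assms(3-5)
proof (induction n arbitrary: x y)
  case (Suc n)
  have "x [^] p = y [^] p"
    by (rule Suc.IH) (use Suc.prems in \<open>simp_all add: nat_pow_pow\<close>)
  then show ?case
    using frobenius_inj[OF p char] Suc.prems(1,2) by blast
qed simp

section \<open>Minimal polynomials of \<open>p\<close>-th roots\<close>

text \<open>
  By Bezout, \<open>w\<close> is a quotient of a power of \<open>w\<^sup>m\<close> and a power of \<open>w\<^sup>n\<close>.
\<close>

lemma (in field) subfield_coprime_powers:
  assumes K: "subfield K R" and w: "w \<in> carrier R"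
    and m: "w [^] (m::nat) \<in> K" and n: "w [^] (n::nat) \<in> K"
    and "coprime m n" and "m > 0"
  shows "w \<in> K"
proof (cases "w = \<zero>")
  case True
  then show ?thesis using subringE(2)[OF subfieldE(1)[OF K]] by simp
next
  case False
  obtain x y where xy: "m * x = n * y + 1"
    using bezout_nat[of m n] assms by auto
  interpret K: ring "R\<lparr>carrier := K\<rparr>"
    using subring_is_ring[OF subfieldE(1)[OF K]] .
  have pow: "a [^] (i::nat) \<in> K" if "a \<in> K" for a i
    using K.nat_pow_closed[of a i] that nat_pow_consistent[of a i K] by simp
  have "w [^] (n * y) \<otimes> w = w [^] (m * x)"
    using w by (simp add: xy)
  also have "\<dots> \<in> K"
    using pow[OF m] w by (simp add: nat_pow_pow)
  finally have "w [^] (n * y) \<otimes> w \<in> K" .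
  moreover have "w [^] (n * y) \<in> K - {\<zero>}"
    using pow[OF n, of y] w False nat_pow_eq_zero[of w "n * y"] by (auto simp: nat_pow_pow)
  ultimately show ?thesis
    using subfield_m_inv_simprule[OF K] w by blast
qed

text \<open>
  A divisor of a product of linear factors is again such a product, and here \<open>X - w\<close> is the only
  linear factor that can occur. Comparing leading coefficients removes the constant factor.
\<close>

lemma (in field) monic_divisor_of_linear_power:
  assumes w: "w \<in> carrier R" and q: "q \<in> carrier (poly_ring R)"
    and monic: "lead_coeff q = \<one>"
    and dvd: "q pdivides ([\<one>, \<ominus> w] [^]\<^bsub>poly_ring R\<^esub> (n::nat))"
  shows "q = [\<one>, \<ominus> w] [^]\<^bsub>poly_ring R\<^esub> degree q"
proof -
  interpret UP: domain "poly_ring R"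
    using univ_poly_is_domain[OF carrier_is_subring] .
  let ?l = "[\<one>, \<ominus> w]"
  have l: "?l \<in> carrier (poly_ring R)"
    using w by (auto simp: univ_poly_def polynomial_def)
  have l_pow: "?l [^]\<^bsub>poly_ring R\<^esub> (i::nat) \<in> carrier (poly_ring R) - {[]}" for i
    using l polynomial_pow_not_zero[OF l] by simp
  have roots: "roots (?l [^]\<^bsub>poly_ring R\<^esub> (i::nat)) = replicate_mset i w" for i
  proof (induction i)
    case 0
    then show ?case
      using degree_zero_imp_empty_roots[OF UP.one_closed] by (simp add: univ_poly_one)
  next
    case (Suc i)
    then show ?case
      using poly_mult_degree_one_monic_imp_same_roots[OF w, of "?l [^]\<^bsub>poly_ring R\<^esub> i"] l_pow[of i] l
      by (simp add: UP.m_comm)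
  qed
  have "splitted (?l [^]\<^bsub>poly_ring R\<^esub> n)"
    unfolding splitted_def roots using polynomial_pow_degree[OF l, of n] by simp
  then have "splitted q"
    using pdivides_imp_splitted[OF q _ _ _ dvd] l_pow by auto
  moreover have "roots q \<subseteq># replicate_mset n w"
    using pdivides_imp_roots_incl[OF q _ _ dvd] l_pow[of n] roots[of n] by simp
  then obtain d where "roots q = replicate_mset d w"
    by (rule msubseteq_replicate_msetE) blast
  ultimately have "alg_mult q w = degree q"
    unfolding splitted_def by (simp add: alg_mult_eq_count_roots[OF q])
  moreover have q0: "q \<noteq> []"
    using dvd l_pow zero_pdivides by auto
  ultimately have "?l [^]\<^bsub>poly_ring R\<^esub> degree q pdivides q"
    using alg_multE(1)[OF w q] by metis
  then obtain r where r: "r \<in> carrier (poly_ring R)"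
      "q = ?l [^]\<^bsub>poly_ring R\<^esub> degree q \<otimes>\<^bsub>poly_ring R\<^esub> r"
    unfolding pdivides_def by auto
  \<comment> \<open>It remains to see that the cofactor \<open>r\<close> is \<open>1\<close>: \<open>q\<close> and the power of \<open>X - w\<close> are monic of the same degree.\<close>
  have lead: "lead_coeff (?l [^]\<^bsub>poly_ring R\<^esub> (i::nat)) = \<one>" for i
  proof (induction i)
    case (Suc i)
    then show ?case
      using poly_mult_lead_coeff[OF carrier_is_subring, of "?l [^]\<^bsub>poly_ring R\<^esub> i" ?l] l l_pow[of i]
      by (simp add: univ_poly_carrier univ_poly_mult)
  qed (simp add: univ_poly_one)
  have "r \<noteq> []"
    using r q0 l_pow[of "degree q"] UP.r_null by (auto simp: univ_poly_zero)
  note mult = poly_mult_degree_eq[OF carrier_is_subring, of "?l [^]\<^bsub>poly_ring R\<^esub> degree q" r]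
    poly_mult_lead_coeff[OF carrier_is_subring, of "?l [^]\<^bsub>poly_ring R\<^esub> degree q" r]
  have "degree r = 0"
    using mult(1) r \<open>r \<noteq> []\<close> l_pow[of "degree q"] polynomial_pow_degree[OF l, of "degree q"]
    by (simp add: univ_poly_carrier univ_poly_mult)
  then obtain c where c: "r = [c]"
    using \<open>r \<noteq> []\<close> by (cases r) auto
  have "c \<in> carrier R"
    using r(1) c by (auto simp: univ_poly_def polynomial_def)
  then have "c = \<one>"
    using mult(2) r \<open>r \<noteq> []\<close> l_pow[of "degree q"] lead[of "degree q"] monic c
    by (simp add: univ_poly_carrier univ_poly_mult)
  then have "r = \<one>\<^bsub>poly_ring R\<^esub>"
    using c by (simp add: univ_poly_one)
  then show ?thesis
    using r(2) l_pow[of "degree q"] by (metis DiffD1 UP.r_one)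
qed

text \<open>
  This is additivity of the Frobenius map of the polynomial ring, applied to \<open>X + a\<close>. The
  hypothesis \<open>a \<noteq> \<zero>\<close> is there because a constant polynomial \<open>a\<close> is represented by the list \<open>[a]\<close>
  only then; the zero polynomial is the empty list.
\<close>

lemma (in field) linear_power_char:
  assumes p: "Factorial_Ring.prime p" and char: "[p] \<cdot> \<one> = \<zero>"
    and a: "a \<in> carrier R" and a0: "a \<noteq> \<zero>"
  shows "[\<one>, a] [^]\<^bsub>poly_ring R\<^esub> (p::nat) = monom \<one> p \<oplus>\<^bsub>poly_ring R\<^esub> [a [^] p]"
proof -
  interpret UP: domain "poly_ring R"
    using univ_poly_is_domain[OF carrier_is_subring] .
  interpret C: ring_hom_ring R "poly_ring R" poly_of_const
    using canonical_embedding_ring_hom[OF carrier_is_subring] by simp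
  have "poly_of_const ([n] \<cdot> \<one>) = [n] \<cdot>\<^bsub>poly_ring R\<^esub> \<one>\<^bsub>poly_ring R\<^esub>" for n :: nat
    by (induction n) simp_all
  then have char': "[p] \<cdot>\<^bsub>poly_ring R\<^esub> \<one>\<^bsub>poly_ring R\<^esub> = \<zero>\<^bsub>poly_ring R\<^esub>"
    using char C.hom_zero by metis
  have const: "poly_of_const c = [c]" if "c \<noteq> \<zero>" for c
    using that by (simp add: poly_of_const_def)
  have "a [^] p \<noteq> \<zero>"
    using nat_pow_eq_zero a a0 by blast
  then have pow: "[a] [^]\<^bsub>poly_ring R\<^esub> p = [a [^] p]"
    using C.hom_nat_pow[OF a, of p] const a0 by simp
  have sum: "[\<one>, a] = X \<oplus>\<^bsub>poly_ring R\<^esub> [a]"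
    using a by (simp add: univ_poly_add var_def)
  have "[a] \<in> carrier (poly_ring R)"
    using C.hom_closed[OF a] const[OF a0] by simp
  then show ?thesis
    unfolding sum unitary_monom_eq_var_pow[OF carrier_is_subring] pow[symmetric]
    by (intro UP.frobenius_add[OF p char'] var_closed(1)[OF carrier_is_subring])
qed

text \<open>
  The coefficients of \<open>(X - w)\<^sup>p = X\<^sup>p - w\<^sup>p\<close> lie in every subfield that contains \<open>w\<^sup>p\<close>, although
  \<open>w\<close> itself need not.
\<close>

lemma (in field) linear_power_over_subfield:
  assumes p: "Factorial_Ring.prime p" and char: "[p] \<cdot> \<one> = \<zero>"
    and K: "subfield K R" and w: "w \<in> carrier R" and w0: "w \<noteq> \<zero>" and wp: "w [^] (p::nat) \<in> K"
  shows "[\<one>, \<ominus> w] [^]\<^bsub>poly_ring R\<^esub> p \<in> carrier (K[X])"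
proof -
  note sub = subfieldE(1)[OF K]
  interpret UK: domain "K[X]"
    using univ_poly_is_domain[OF sub] .
  have "(\<ominus> w) [^] p \<oplus> w [^] p = (\<ominus> w \<oplus> w) [^] p"
    by (rule frobenius_add[OF p char, symmetric]) (use w in auto)
  also have "\<dots> = \<zero>"
    using w p by (simp add: l_neg nat_pow_zero prime_gt_0_nat)
  finally have neg: "(\<ominus> w) [^] p = \<ominus> (w [^] p)"
    using w by (simp add: sum_zero_eq_neg)
  have "[\<one>, \<ominus> w] [^]\<^bsub>poly_ring R\<^esub> p = monom \<one> p \<oplus>\<^bsub>K[X]\<^esub> [(\<ominus> w) [^] p]"
    using linear_power_char[OF p char, of "\<ominus> w"] w w0 by (simp add: univ_poly_add)
  moreover have "monom \<one> p \<in> carrier (K[X])"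
    using var_pow_closed[OF sub] unitary_monom_eq_var_pow[OF sub] by simp
  moreover have "[(\<ominus> w) [^] p] \<in> carrier (K[X])"
    using nat_pow_eq_zero[of "\<ominus> w" p] w w0 wp neg subringE(5)[OF sub]
    by (auto simp: univ_poly_def polynomial_def)
  ultimately show ?thesis by simp
qed

lemma (in field) eval_linear_power:
  assumes "w \<in> carrier R" and "x \<in> carrier R"
  shows "eval ([\<one>, \<ominus> w] [^]\<^bsub>poly_ring R\<^esub> (n::nat)) x = (x \<ominus> w) [^] n"
proof -
  have "[\<one>, \<ominus> w] \<in> carrier (poly_ring R)"
    using assms by (auto simp: univ_poly_def polynomial_def)
  then show ?thesis
    using ring_hom_ring.hom_nat_pow[OF eval_ring_hom[OF carrier_is_subring assms(2)]] assms
    by (simp add: a_minus_def)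
qed

text \<open>
  The key fact: if \<open>w\<^sup>p \<in> K\<close> but \<open>w \<notin> K\<close>, then \<open>w\<close> has degree at least \<open>p\<close> over \<open>K\<close>. Indeed the
  minimal polynomial \<open>q\<close> of \<open>w\<close> over \<open>K\<close> divides \<open>X\<^sup>p - w\<^sup>p = (X - w)\<^sup>p\<close>, so it is \<open>(X - w)\<^sup>d\<close> for
  some \<open>d \<ge> 1\<close>, and its constant coefficient shows \<open>w\<^sup>d \<in> K\<close> (up to sign). If \<open>d < p\<close>, then \<open>d\<close> and
  \<open>p\<close> are coprime and \<open>w\<close> would lie in \<open>K\<close>.
\<close>

lemma (in field) purely_inseparable_degree_ge:
  assumes p: "Factorial_Ring.prime p" and char: "[p] \<cdot> \<one> = \<zero>"
    and K: "subfield K R" and w: "w \<in> carrier R" and wp: "w [^] (p::nat) \<in> K" and wK: "w \<notin> K"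
    and g: "g \<in> carrier (K[X])" and root: "eval g w = \<zero>" and g0: "g \<noteq> []"
  shows "p \<le> degree g"
proof -
  note sub = subfieldE(1)[OF K]
  let ?A = "[\<one>, \<ominus> w] [^]\<^bsub>poly_ring R\<^esub> p"
  have "w \<noteq> \<zero>"
    using wK subringE(2)[OF sub] by auto
  then have AK: "?A \<in> carrier (K[X])"
    using linear_power_over_subfield[OF p char K w _ wp] by simp
  have A_root: "eval ?A w = \<zero>"
    using eval_linear_power[OF w w] w p by (simp add: a_minus_def r_neg nat_pow_zero prime_gt_0_nat)
  have alg: "(algebraic over K) w"
    using algebraicI[OF g g0 root] by (simp add: over_def)
  define q where "q = Irr K w"
  note Irr = IrrE[OF K w alg, folded q_def]
  have qR: "q \<in> carrier (poly_ring R)"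
    using carrier_polynomial_shell[OF sub Irr(1)] .
  have "q = [\<one>, \<ominus> w] [^]\<^bsub>poly_ring R\<^esub> degree q"
    using monic_divisor_of_linear_power[OF w qR Irr(3)] Irr_minimal[OF K w alg AK A_root]
    by (simp add: q_def)
  \<comment> \<open>Evaluating at \<open>0\<close> turns \<open>(X - w)\<^sup>d\<close> into a power of \<open>- w\<close>.\<close>
  moreover have "const_term q \<in> K"
    using const_term_simprules_shell(1)[OF sub Irr(1)] .
  ultimately have wd: "(\<ominus> w) [^] degree q \<in> K"
    using eval_linear_power[OF w zero_closed, of "degree q"] w by (simp add: const_term_def a_minus_def)
  have wp': "(\<ominus> w) [^] p \<in> K"
    using const_term_simprules_shell(1)[OF sub AK] eval_linear_power[OF w zero_closed, of p] w
    by (simp add: const_term_def a_minus_def)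
  have d: "degree q \<ge> 1"
    using pirreducible_degree[OF K Irr(1,2)] .
  have "degree q \<le> degree g"
    using pdivides_imp_degree_le[OF sub Irr(1) g g0] Irr_minimal[OF K w alg g root]
    by (simp add: q_def)
  moreover have "\<not> degree q < p"
  proof
    assume "degree q < p"
    then have "coprime (degree q) p"
      using prime_imp_coprime_nat[OF p, of "degree q"] nat_dvd_not_less[of "degree q" p] d
      by (simp add: coprime_commute)
    then have "\<ominus> w \<in> K"
      using subfield_coprime_powers[OF K _ wd wp'] w d by simp
    then show False
      using wK w subringE(5)[OF sub, of "\<ominus> w"] by simp
  qed
  ultimately show ?thesis by simp
qed

text \<open>
  An element \<open>v\<close> of \<open>F(w)\<close> is \<open>r(w)\<close> for some polynomial \<open>r\<close> over \<open>F\<close> of degree less than \<open>p\<close>: divide by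
  \<open>X\<^sup>p - w\<^sup>p\<close>. If \<open>v\<close> also lies in \<open>K\<close>, then \<open>r - v\<close> is a polynomial over \<open>K\<close> of degree less than \<open>p\<close>
  with root \<open>w\<close>, hence zero. So \<open>r\<close> is the constant \<open>v\<close>, and \<open>v \<in> F\<close>.
\<close>

lemma (in field) inter_simple_extension_eq:
  assumes p: "Factorial_Ring.prime p" and char: "[p] \<cdot> \<one> = \<zero>"
    and F: "subfield F R" and K: "subfield K R" and FK: "F \<subseteq> K"
    and w: "w \<in> carrier R" and wp: "w [^] (p::nat) \<in> F" and wK: "w \<notin> K"
  shows "simple_extension F w \<inter> K = F"
proof
  show "F \<subseteq> simple_extension F w \<inter> K"
    using simple_extension_incl[OF subfieldE(3)[OF F] w] FK by blast
  show "simple_extension F w \<inter> K \<subseteq> F"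
  proof
    fix v assume v: "v \<in> simple_extension F w \<inter> K"
    note subF = subfieldE(1)[OF F] and subK = subfieldE(1)[OF K]
    have vR: "v \<in> carrier R"
      using v subfieldE(3)[OF K] by auto
    interpret UP: domain "poly_ring R"
      using univ_poly_is_domain[OF carrier_is_subring] .
    interpret UK: domain "K[X]"
      using univ_poly_is_domain[OF subK] .
    interpret C: ring_hom_ring R "poly_ring R" poly_of_const
      using canonical_embedding_ring_hom[OF carrier_is_subring] by simp
    interpret EF: ring_hom_ring "F[X]" R "\<lambda>q. eval q w"
      using eval_ring_hom[OF subF w] .
    interpret EK: ring_hom_ring "K[X]" R "\<lambda>q. eval q w"
      using eval_ring_hom[OF subK w] .
    have "w \<noteq> \<zero>"
      using wK subringE(2)[OF subK] by auto
    let ?l = "[\<one>, \<ominus> w]"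
    let ?A = "?l [^]\<^bsub>poly_ring R\<^esub> p"
    have l: "?l \<in> carrier (poly_ring R)"
      using w by (auto simp: univ_poly_def polynomial_def)
    have A: "?A \<in> carrier (F[X])" "?A \<noteq> \<zero>\<^bsub>F[X]\<^esub>" "degree ?A = p" "eval ?A w = \<zero>"
      using linear_power_over_subfield[OF p char F w \<open>w \<noteq> \<zero>\<close> wp] polynomial_pow_not_zero[OF l, of p]
        polynomial_pow_degree[OF l, of p] eval_linear_power[OF w w, of p] w p
      by (simp_all add: a_minus_def r_neg univ_poly_zero nat_pow_zero prime_gt_0_nat)
    obtain f where f: "f \<in> carrier (F[X])" "v = eval f w"
      using v simple_extension_as_eval_img[OF subfieldE(3)[OF F] w] by auto
    obtain q r where qr: "q \<in> carrier (F[X])" "r \<in> carrier (F[X])"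
        "f = ?A \<otimes>\<^bsub>F[X]\<^esub> q \<oplus>\<^bsub>F[X]\<^esub> r" "r = \<zero>\<^bsub>F[X]\<^esub> \<or> degree r < degree ?A"
      using subfield_long_division_theorem_shell[OF F f(1) A(1,2)] by blast
    have vr: "v = eval r w"
      using f qr A by simp
    have r_deg: "degree r < p"
      using qr(4) A(3) p by (auto simp: univ_poly_zero prime_gt_0_nat)
    have rK: "r \<in> carrier (K[X])"
      using qr(2) FK by (auto simp: univ_poly_def polynomial_def)
    let ?c = "poly_of_const (\<ominus> v)"
    have c: "?c \<in> carrier (K[X])" "eval ?c w = \<ominus> v" "degree ?c = 0"
      using v vR w subringE(5)[OF subK]
      by (auto simp: poly_of_const_def univ_poly_def polynomial_def)
    let ?g = "r \<oplus>\<^bsub>K[X]\<^esub> ?c"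
    have "eval ?g w = \<zero>"
      using rK c vr vR by (simp add: r_neg)
    moreover have "degree ?g < p"
      using poly_add_degree[of r ?c] r_deg c(3) by (simp add: univ_poly_add)
    ultimately have "?g = []"
      using purely_inseparable_degree_ge[OF p char K w _ wK, of ?g] wp FK rK c(1) by force
    then have "r \<oplus>\<^bsub>poly_ring R\<^esub> \<ominus>\<^bsub>poly_ring R\<^esub> poly_of_const v = \<zero>\<^bsub>poly_ring R\<^esub>"
      using vR by (simp add: univ_poly_add univ_poly_zero)
    then have "r = poly_of_const v"
      using carrier_polynomial_shell[OF subF qr(2)] vR UP.r_right_minus_eq
      by (simp add: a_minus_def)
    then show "v \<in> F"
      using qr(2) subringE(2)[OF subF]
      by (cases "v = \<zero>") (auto simp: poly_of_const_def univ_poly_def polynomial_def)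
  qed
qed

section \<open>Radicial extensions\<close>

lemma (in domain) add_pow_one_eq_zero_iff:
  "[n] \<cdot> \<one> = \<zero> \<longleftrightarrow> field_char R dvd (n::nat)"
  using group.pow_eq_id[OF add.is_group, of \<one> n] by (simp add: add_pow_def field_char_def)

lemma (in domain) prime_field_char:
  assumes "field_char R \<noteq> 0"
  shows "Factorial_Ring.prime (field_char R)"
proof (unfold prime_nat_iff, intro conjI allI impI)
  let ?p = "field_char R"
  have "?p \<noteq> 1"
  proof
    assume "?p = 1"
    then show False using add_pow_one_eq_zero_iff[of 1] by simp
  qed
  then show "1 < ?p" using assms by simp
  fix m assume "m dvd ?p"
  then obtain c where c: "?p = m * c" by (elim dvdE)
  have "([m] \<cdot> \<one>) \<otimes> ([c] \<cdot> \<one>) = [?p] \<cdot> \<one>"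
    unfolding c by (simp add: add_pow_ldistr add.nat_pow_pow mult.commute)
  then have "[m] \<cdot> \<one> = \<zero> \<or> [c] \<cdot> \<one> = \<zero>"
    using add_pow_one_eq_zero_iff[of ?p] by (auto simp: integral_iff)
  then have "?p dvd m \<or> ?p dvd c"
    using add_pow_one_eq_zero_iff by blast
  then show "m = 1 \<or> m = ?p"
    using c assms by (auto dest: dvd_imp_le)
qed

text \<open>
  If \<open>x\<^sup>m\<close> is a nonzero element of \<open>k\<close>, then \<open>x\<^sup>m\<^sup>-\<^sup>1 (x\<^sup>m)\<^sup>-\<^sup>1\<close> is the inverse of \<open>x\<close>, and it lies in every
  \<open>k\<close>-subalgebra that contains \<open>x\<close>.
\<close>

lemma (in field) subfield_of_radical_subalg:
  assumes k: "subfield k R" and rad: "radicial_ext k R" and T: "T \<in> subalgs k R"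
  shows "subfield T R"
proof (rule subfieldI')
  have sub: "subring T R" and kT: "k \<subseteq> T"
    using T by (auto simp: subalgs_def)
  show "subring T R" by fact
  fix x assume x: "x \<in> T - {\<zero>}"
  then have xR: "x \<in> carrier R"
    using subringE(1)[OF sub] by auto
  obtain n where "x [^] (char_exponent R ^ n) \<in> k"
    using rad xR by (auto simp: radicial_ext_def)
  moreover have "char_exponent R ^ n > 0"
    by (simp add: char_exponent_def)
  ultimately obtain m where m: "x [^] Suc m \<in> k"
    using gr0_implies_Suc by metis
  have pow: "x [^] i \<in> T" for i :: nat
    using x subringE(3,6)[OF sub] by (induction i) auto
  have "x [^] Suc m \<in> k - {\<zero>}"
    using m nat_pow_eq_zero[OF xR, of "Suc m"] x by blast
  note inv = subfield_m_inv[OF k this]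
  have invR: "inv (x [^] Suc m) \<in> carrier R"
    using inv(1) subfieldE(3)[OF k] by auto
  then have "x \<otimes> (x [^] m \<otimes> inv (x [^] Suc m)) = \<one>"
    using inv(2) xR by (simp add: m_ac)
  then have "inv x = x [^] m \<otimes> inv (x [^] Suc m)"
    using xR invR by (intro comm_inv_char) auto
  then show "inv x \<in> T"
    using subringE(6)[OF sub pow[of m]] inv(1) kT by auto
qed

text \<open>
  Finite fields are perfect: the powers of the Frobenius map are injective, hence surjective on
  \<open>k\<close>. So if \<open>x\<^sup>m \<in> k\<close> for a power \<open>m\<close> of the characteristic exponent, then \<open>x\<^sup>m = y\<^sup>m\<close> for some \<open>y \<in> k\<close>, and
  \<open>x = y\<close>.
\<close>

lemma (in field) eq_of_finite_radicial:
  assumes k: "subfield k R" and rad: "radicial_ext k R" and fin: "finite k"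
  shows "carrier R = k"
proof
  note sub = subfieldE(1)[OF k]
  show "k \<subseteq> carrier R" using subringE(1)[OF sub] .
  show "carrier R \<subseteq> k"
  proof
    fix x assume x: "x \<in> carrier R"
    let ?q = "char_exponent R"
    obtain n where n: "x [^] (?q ^ n) \<in> k"
      using rad x by (auto simp: radicial_ext_def)
    show "x \<in> k"
    proof (cases "field_char R = 0")
      case True
      then show ?thesis using n x by (simp add: char_exponent_def)
    next
      case False
      then have q: "Factorial_Ring.prime ?q" "[?q] \<cdot> \<one> = \<zero>"
        using prime_field_char add_pow_one_eq_zero_iff by (auto simp: char_exponent_def)
      have pow: "y [^] i \<in> k" if "y \<in> k" for y and i :: nat
        using that subringE(3,6)[OF sub] by (induction i) auto
      have inj: "y = z" if "y \<in> carrier R" "z \<in> carrier R" "y [^] (?q ^ n) = z [^] (?q ^ n)" for y z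
        using frobenius_pow_inj[OF q that] .
      have "(\<lambda>y. y [^] (?q ^ n)) ` k = k"
        using fin subringE(1)[OF sub] pow inj by (intro endo_inj_surj inj_onI) blast+
      then obtain y where y: "y \<in> k" "x [^] (?q ^ n) = y [^] (?q ^ n)"
        using n by (metis (no_types, lifting) imageE)
      then have "x = y"
        using inj[OF x] subringE(1)[OF sub] by blast
      then show ?thesis using y by simp
    qed
  qed
qed

text \<open>
  Raise an element of \<open>T\<close> outside \<open>U\<close> to the power of the characteristic exponent \<open>q\<close> until it falls
  into \<open>U\<close>, and take the last power before that. In characteristic \<open>0\<close> there is no such element,
  because radiciality then puts all of \<open>L\<close> into \<open>k\<close>.
\<close>

lemma (in field) radicial_subalg_minus_obtain:
  assumes rad: "radicial_ext k R" and T: "T \<in> subalgs k R" and U: "U \<in> subalgs k R"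
    and "\<not> T \<subseteq> U"
  obtains t where "t \<in> T" "t \<notin> U" "t [^] char_exponent R \<in> U"
proof -
  let ?q = "char_exponent R"
  obtain x where x: "x \<in> T" "x \<notin> U" using assms by auto
  have subT: "subring T R" and kU: "k \<subseteq> U"
    using T U by (auto simp: subalgs_def)
  have xR: "x \<in> carrier R" using x(1) subringE(1)[OF subT] by auto
  have "\<exists>n::nat. x [^] (?q ^ n) \<in> U"
    using rad xR kU by (auto simp: radicial_ext_def)
  then obtain n where n: "x [^] (?q ^ n) \<in> U" "\<forall>m<n. x [^] (?q ^ m) \<notin> U"
    using exists_least_iff[of "\<lambda>n. x [^] (?q ^ n) \<in> U"] by blast
  have "n \<noteq> 0" using n x xR by (intro notI) simp
  then obtain m where m: "n = Suc m" using not0_implies_Suc by blast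
  have "x [^] i \<in> T" for i :: nat
    using x(1) subringE(3,6)[OF subT] by (induction i) auto
  then show thesis
    using that[of "x [^] (?q ^ m)"] n m xR by (simp add: nat_pow_pow mult.commute)
qed

text \<open>
  Two incomparable subalgebras \<open>T\<close> and \<open>U\<close> yield a whole family of further ones: the
  \<open>q\<close>-th power of \<open>w = t + c u\<close> lies in \<open>T \<inter> U\<close>, while \<open>w\<close> lies neither in \<open>T\<close> nor in \<open>U\<close>. So
  \<open>inter_simple_extension_eq\<close>, applied with \<open>F = T \<inter> U\<close>, shows that \<open>F(w)\<close> meets \<open>T\<close> and \<open>U\<close>
  only in \<open>F\<close>, like a diagonal line meets the two coordinate axes.
\<close>

lemma (in field) incomparable_pair_diagonal:
  assumes k: "subfield k R" and rad: "radicial_ext k R"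
    and T: "T \<in> subalgs k R" and U: "U \<in> subalgs k R"
    and t: "t \<in> T" "t \<notin> U" "t [^] char_exponent R \<in> U"
    and u: "u \<in> U" "u \<notin> T" "u [^] char_exponent R \<in> T"
    and c: "c \<in> k - {\<zero>}"
  defines "W \<equiv> simple_extension (T \<inter> U) (t \<oplus> c \<otimes> u)"
  shows "W \<in> subalgs k R" and "t \<oplus> c \<otimes> u \<in> W"
    and "W \<inter> T = T \<inter> U" and "W \<inter> U = T \<inter> U"
proof -
  let ?q = "char_exponent R" and ?w = "t \<oplus> c \<otimes> u"
  have subT: "subring T R" and subU: "subring U R" and kT: "k \<subseteq> T" and kU: "k \<subseteq> U"
    using T U by (auto simp: subalgs_def)
  have subF: "subring (T \<inter> U) R"
    using subring_inter[OF subT subU] .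
  have fields: "subfield T R" "subfield U R" "subfield (T \<inter> U) R"
    using subfield_of_radical_subalg[OF k rad] T U subF kT kU by (auto simp: subalgs_def)
  have tR: "t \<in> carrier R" and uR: "u \<in> carrier R" and cR: "c \<in> carrier R"
    using t u c subringE(1)[OF subT] subringE(1)[OF subU] kT by auto
  have wR: "?w \<in> carrier R" using tR uR cR by simp
  show "W \<in> subalgs k R"
    unfolding W_def using simple_extension_is_subring[OF subF wR]
      simple_extension_incl[OF subringE(1)[OF subF] wR] kT kU by (auto simp: subalgs_def)
  show "?w \<in> W"
    unfolding W_def using simple_extension_mem[OF subF wR] .
  \<comment> \<open>In characteristic \<open>0\<close> the exponent is \<open>1\<close>, and \<open>t\<close> would lie in \<open>U\<close>.\<close>
  have "field_char R \<noteq> 0"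
    using t tR by (auto simp: char_exponent_def split: if_splits)
  then have q: "Factorial_Ring.prime ?q" "[?q] \<cdot> \<one> = \<zero>"
    using prime_field_char add_pow_one_eq_zero_iff by (auto simp: char_exponent_def)
  have pow: "y [^] i \<in> S" if "y \<in> S" "subring S R" for y S and i :: nat
    using that subringE(3,6)[OF that(2)] by (induction i) auto
  have "?w [^] ?q = t [^] ?q \<oplus> c [^] ?q \<otimes> u [^] ?q"
    using frobenius_add[OF q tR, of "c \<otimes> u"] tR uR cR by (simp add: nat_pow_distrib)
  moreover have "t [^] ?q \<in> T" "u [^] ?q \<in> U" "c [^] ?q \<in> T \<inter> U"
    using pow t u c subT subU kT kU by auto
  ultimately have wq: "?w [^] ?q \<in> T \<inter> U"
    using t u subringE(6,7)[OF subT] subringE(6,7)[OF subU] by auto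
  have wT: "?w \<notin> T"
  proof
    assume "?w \<in> T"
    then have "\<ominus> t \<oplus> ?w \<in> T"
      using t subringE(5,7)[OF subT] by blast
    then have "c \<otimes> u \<in> T"
      using tR uR cR by (simp add: r_neg1 r_neg2)
    then show False
      using subfield_m_inv_simprule[OF fields(1), of c u] c kT uR u by auto
  qed
  have wU: "?w \<notin> U"
  proof
    assume "?w \<in> U"
    moreover have "\<ominus> (c \<otimes> u) \<in> U"
      using u c kU subringE(5,6)[OF subU] by blast
    ultimately have "?w \<oplus> \<ominus> (c \<otimes> u) \<in> U"
      using subringE(7)[OF subU] by blast
    then show False
      using t tR uR cR by (simp add: a_assoc r_neg)
  qed
  show "W \<inter> T = T \<inter> U" "W \<inter> U = T \<inter> U"
    unfolding W_def
    using inter_simple_extension_eq[OF q fields(3,1) _ wR wq wT]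
      inter_simple_extension_eq[OF q fields(3,2) _ wR wq wU] by auto
qed

section \<open>The three conditions\<close>

lemma chained_ext_iff:
  "chained_ext k L \<longleftrightarrow> (\<forall>T\<in>subalgs k L. \<forall>U\<in>subalgs k L. T \<subseteq> U \<or> U \<subseteq> T)"
  unfolding chained_ext_def total_order_def total_order_axioms_def
  using partial_order_subalg_lattice[of k L] by (simp add: Ball_def)

lemma (in ring) distributive_ext_iff:
  "distributive_ext k R \<longleftrightarrow> (\<forall>T\<in>subalgs k R. \<forall>U\<in>subalgs k R. \<forall>V\<in>subalgs k R.
     T \<inter> generate_ring R (U \<union> V) = generate_ring R ((T \<inter> U) \<union> (T \<inter> V)))"
proof -
  have meet: "T \<inter> U \<in> subalgs k R" if "T \<in> subalgs k R" "U \<in> subalgs k R" for T U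
    using greatest_subalg_inter[OF that] by (auto simp: greatest_def Lower_def)
  have join: "generate_ring R (T \<union> U) \<in> subalgs k R"
    if "T \<in> subalgs k R" "U \<in> subalgs k R" for T U
    using least_subalg_compositum[OF that] by (auto simp: least_def Upper_def)
  show ?thesis
    by (simp add: distributive_ext_def distributive_lattice_def lattice_subalg_lattice
        meet_subalg_lattice join_subalg_lattice meet join)
qed

lemma (in ring) generate_ring_subalg:
  assumes "T \<in> subalgs k R"
  shows "generate_ring R T = T"
  using assms generate_ring_min_subring1[of T T] subringE(1)[of T R] generate_ring.incl[of _ T R]
  by (auto simp: subalgs_def)

text \<open>
  In a chain the compositum of two members is their union, and intersection distributes over union.
\<close>

lemma (in ring) chained_imp_distributive_ext:
  assumes "chained_ext k R"
  shows "distributive_ext k R"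
  unfolding distributive_ext_iff
proof (intro ballI)
  fix T U V assume S: "T \<in> subalgs k R" "U \<in> subalgs k R" "V \<in> subalgs k R"
  have "A \<union> B = A \<or> A \<union> B = B" if "A \<in> subalgs k R" "B \<in> subalgs k R" for A B
    using assms that unfolding chained_ext_iff by blast
  then have "U \<union> V \<in> subalgs k R"
    using S by metis
  moreover have "T \<inter> (U \<union> V) \<in> subalgs k R"
    using greatest_subalg_inter[OF S(1) calculation] by (auto simp: greatest_def Lower_def)
  ultimately show "T \<inter> generate_ring R (U \<union> V) = generate_ring R ((T \<inter> U) \<union> (T \<inter> V))"
    by (simp add: generate_ring_subalg flip: Int_Un_distrib)
qed

text \<open>
  If \<open>T\<close> and \<open>U\<close> are incomparable, the subalgebra \<open>W\<close> generated over \<open>T \<inter> U\<close> by \<open>w = t + u\<close> violates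
  distributivity: \<open>w\<close> lies in the compositum \<open>TU\<close>, so \<open>W \<inter> TU\<close> contains \<open>w\<close>, but \<open>W \<inter> T\<close> and
  \<open>W \<inter> U\<close> are both \<open>T \<inter> U\<close>, and so is their compositum.
\<close>

lemma (in field) distributive_imp_chained_ext:
  assumes k: "subfield k R" and rad: "radicial_ext k R" and "distributive_ext k R"
  shows "chained_ext k R"
  unfolding chained_ext_iff
proof (intro ballI, rule ccontr)
  fix T U assume T: "T \<in> subalgs k R" and U: "U \<in> subalgs k R" and "\<not> (T \<subseteq> U \<or> U \<subseteq> T)"
  then obtain t u where t: "t \<in> T" "t \<notin> U" "t [^] char_exponent R \<in> U"
    and u: "u \<in> U" "u \<notin> T" "u [^] char_exponent R \<in> T"
    using radicial_subalg_minus_obtain[OF rad] by metis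
  \<comment> \<open>The factor \<open>\<one>\<close> makes \<open>w\<close> an instance of \<open>t + c u\<close> verbatim.\<close>
  define w where "w = t \<oplus> \<one> \<otimes> u"
  define W where "W = simple_extension (T \<inter> U) w"
  have "\<one> \<in> k - {\<zero>}"
    using subringE(3)[OF subfieldE(1)[OF k]] by simp
  note W = incomparable_pair_diagonal[OF k rad T U t u this, folded w_def, folded W_def]
  have subT: "subring T R" and subU: "subring U R"
    using T U by (auto simp: subalgs_def)
  have F: "T \<inter> U \<in> subalgs k R"
    using greatest_subalg_inter[OF T U] by (auto simp: greatest_def Lower_def)
  have uR: "u \<in> carrier R" and tR: "t \<in> carrier R"
    using t u subringE(1)[OF subU] subringE(1)[OF subT] by auto
  have "T \<union> U \<subseteq> carrier R"
    using subringE(1)[OF subT] subringE(1)[OF subU] by simp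
  then have "w \<in> generate_ring R (T \<union> U)"
    using t u uR unfolding w_def by (auto intro: generate_ring.incl generate_ring.eng_add)
  moreover have "W \<inter> generate_ring R (T \<union> U) = generate_ring R ((W \<inter> T) \<union> (W \<inter> U))"
    using assms(3) W(1) T U unfolding distributive_ext_iff by blast
  ultimately have "w \<in> T \<inter> U"
    using W(2,3,4) generate_ring_subalg[OF F] by auto
  then have "\<ominus> t \<oplus> w \<in> T"
    using t subringE(5,7)[OF subT] by blast
  then show False
    using u uR tR by (simp add: w_def r_neg1)
qed

text \<open>
  If \<open>T\<close> and \<open>U\<close> are incomparable, the subalgebras \<open>W c\<close> generated over \<open>T \<inter> U\<close> by \<open>t + c u\<close> are
  pairwise distinct for nonzero \<open>c \<in> k\<close>: one that contained two of these generators would contain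
  \<open>u\<close>, but its intersection with \<open>U\<close> is \<open>T \<inter> U\<close>. So \<open>k\<close> is finite, and the extension is trivial.
\<close>

lemma (in field) FIP_imp_chained_ext:
  assumes k: "subfield k R" and rad: "radicial_ext k R" and "FIP k R"
  shows "chained_ext k R"
  unfolding chained_ext_iff
proof (intro ballI, rule ccontr)
  fix T U assume T: "T \<in> subalgs k R" and U: "U \<in> subalgs k R" and incomp: "\<not> (T \<subseteq> U \<or> U \<subseteq> T)"
  then obtain t u where t: "t \<in> T" "t \<notin> U" "t [^] char_exponent R \<in> U"
    and u: "u \<in> U" "u \<notin> T" "u [^] char_exponent R \<in> T"
    using radicial_subalg_minus_obtain[OF rad] by metis
  define W where "W c = simple_extension (T \<inter> U) (t \<oplus> c \<otimes> u)" for c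
  note W = incomparable_pair_diagonal[OF k rad T U t u, folded W_def]
  have subT: "subring T R" and subU: "subring U R"
    using T U by (auto simp: subalgs_def)
  have uR: "u \<in> carrier R" and tR: "t \<in> carrier R"
    using t u subringE(1)[OF subU] subringE(1)[OF subT] by auto
  have "inj_on W (k - {\<zero>})"
  proof (rule inj_onI, rule ccontr)
    fix c d assume c: "c \<in> k - {\<zero>}" and d: "d \<in> k - {\<zero>}" and eq: "W c = W d" and "c \<noteq> d"
    have cR: "c \<in> carrier R" and dR: "d \<in> carrier R"
      using c d subfieldE(3)[OF k] by auto
    have sub: "subring (W c) R" and kW: "k \<subseteq> W c"
      using W(1)[OF c] by (auto simp: subalgs_def)
    have "(t \<oplus> c \<otimes> u) \<oplus> \<ominus> (t \<oplus> d \<otimes> u) \<in> W c"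
      using W(2)[OF c] W(2)[OF d] eq subringE(5,7)[OF sub] by simp
    also have "(t \<oplus> c \<otimes> u) \<oplus> \<ominus> (t \<oplus> d \<otimes> u) = (c \<ominus> d) \<otimes> u"
      using tR uR cR dR by algebra
    finally have "(c \<ominus> d) \<otimes> u \<in> W c" .
    moreover have "c \<ominus> d \<in> W c"
      using c d kW subringE(5,7)[OF sub] unfolding a_minus_def by blast
    moreover have "c \<ominus> d \<noteq> \<zero>"
      using cR dR \<open>c \<noteq> d\<close> by simp
    ultimately have "u \<in> W c"
      using subfield_m_inv_simprule[OF subfield_of_radical_subalg[OF k rad W(1)[OF c]]] uR by blast
    then show False
      using u W(4)[OF c] by auto
  qed
  moreover have "W ` (k - {\<zero>}) \<subseteq> subalgs k R"
    using W(1) by blast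
  ultimately have "finite (k - {\<zero>})"
    using \<open>FIP k R\<close> unfolding FIP_def by (meson finite_imageD finite_subset)
  then have "carrier R = k"
    using eq_of_finite_radicial[OF k rad] by simp
  then have "T \<subseteq> U"
    using T U subringE(1)[OF subT] by (auto simp: subalgs_def)
  then show False using incomp by simp
qed

lemma FCP_chained_imp_FIP:
  assumes "FCP k L" and "chained_ext k L"
  shows "FIP k L"
proof -
  have "subset.chain (subalgs k L) (subalgs k L)"
    using assms(2) by (auto simp: chained_ext_iff subset.chain_def)
  then show ?thesis
    using assms(1) by (simp add: FCP_def FIP_def)
qed

theorem proposition9p8:
  fixes L :: "('a, 'b) ring_scheme" and k :: "'a set"
  assumes "field L" and "subfield k L"
    and "FCP k L" and "radicial_ext k L"
  shows "(chained_ext k L \<longleftrightarrow> distributive_ext k L) \<and> (distributive_ext k L \<longleftrightarrow> FIP k L)"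
proof -
  interpret field L by fact
  show ?thesis
    using chained_imp_distributive_ext distributive_imp_chained_ext FIP_imp_chained_ext
      FCP_chained_imp_FIP assms by blast
qed

end
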